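(* Every almost topological group $G$ is completely regular.
   Context: A pre-topology on a set $Z$ is a family $\mathscr{T}$ of subsets of $Z$ with $\bigcup\mathscr{T}=Z$ that is closed under arbitrary unions (in particular $\emptyset\in\mathscr{T}$); it need not be closed under finite intersections. Members of $\mathscr{T}$ are called open, their complements closed. A map between pre-topological spaces is pre-continuous if preimages of open sets are open. For a pre-topological space $G$, the product pre-topology on $G\times G$ has as open sets exactly the unions of sets $U\times V$ with $U,V$ open in $G$. A pre-topological group is a group $G$ with a pre-topology such that the multiplication $G\times G\to G$ and the inversion $G\to G$ are pre-continuous. A pre-base at a point $z$ is a family of open sets containing $z$ such that every open set containing $z$ contains a member of the family. An almost topological group is a pre-topological group $G$ having a pre-base $\mathscr{B}_e$ at the neutral element $e$ such that $U=U^{-1}$ for each $U\in\mathscr{B}_e$ and for each $U\in\mathscr{B}_e$ there is $V\in\mathscr{B}_e$ with $V^2\subseteq U$. A pre-topological space $Z$ is $T_{1}$ if for any distinct $y,z\in Z$ there are open $V,W$ with $V\cap\{y,z\}=\{y\}$ and $W\cap\{y,z\}=\{z\}$. It is completely regular if it is $T_{1}$ and for each $z\in Z$ and each closed $C\subseteq Z$ with $z\notin C$ there is a pre-continuous map $r:Z\to[0,1]$ (with $[0,1]$ carrying its usual topology) such that $r(z)=0$ and $r(x)=1$ for all $x\in C$.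
   Formalization: Complete regularity includes T1, which fails for a nontrivial group with the indiscrete pre-topology; so complete regularity is proved for T0 almost topological groups, and separation of points from closed sets by pre-continuous maps to [0,1] is proved for all of them. *)

theory Defs
  imports "HOL-Analysis.Analysis" "HOL-Algebra.Coset"
begin

definition pretopology_on :: "'a set \<Rightarrow> 'a set set \<Rightarrow> bool" where
  "pretopology_on Z T \<longleftrightarrow> \<Union>T = Z \<and> (\<forall>K. K \<subseteq> T \<longrightarrow> \<Union>K \<in> T)"

definition precontinuous_map ::
    "'a set \<Rightarrow> 'a set set \<Rightarrow> 'b set \<Rightarrow> 'b set set \<Rightarrow> ('a \<Rightarrow> 'b) \<Rightarrow> bool" where
  "precontinuous_map Z S Y T f \<longleftrightarrow> f \<in> Z \<rightarrow> Y \<and> (\<forall>V\<in>T. {x \<in> Z. f x \<in> V} \<in> S)"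

definition prod_pretopology :: "'a set set \<Rightarrow> 'b set set \<Rightarrow> ('a \<times> 'b) set set" where
  "prod_pretopology S T = {\<Union>K | K. K \<subseteq> {U \<times> V | U V. U \<in> S \<and> V \<in> T}}"

definition pretopological_group :: "('a, 'b) monoid_scheme \<Rightarrow> 'a set set \<Rightarrow> bool" where
  "pretopological_group G T \<longleftrightarrow>
     group G \<and> pretopology_on (carrier G) T \<and>
     precontinuous_map (carrier G \<times> carrier G) (prod_pretopology T T) (carrier G) T
       (\<lambda>(x, y). x \<otimes>\<^bsub>G\<^esub> y) \<and>
     precontinuous_map (carrier G) T (carrier G) T (\<lambda>x. inv\<^bsub>G\<^esub> x)"

definition prebase_at :: "'a set set \<Rightarrow> 'a \<Rightarrow> 'a set set \<Rightarrow> bool" where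
  "prebase_at T z B \<longleftrightarrow>
     (\<forall>U\<in>B. U \<in> T \<and> z \<in> U) \<and> (\<forall>W\<in>T. z \<in> W \<longrightarrow> (\<exists>U\<in>B. U \<subseteq> W))"

definition almost_topological_group :: "('a, 'b) monoid_scheme \<Rightarrow> 'a set set \<Rightarrow> bool" where
  "almost_topological_group G T \<longleftrightarrow>
     pretopological_group G T \<and>
     (\<exists>B. prebase_at T \<one>\<^bsub>G\<^esub> B \<and>
       (\<forall>U\<in>B. U = set_inv\<^bsub>G\<^esub> U) \<and>
       (\<forall>U\<in>B. \<exists>V\<in>B. V <#>\<^bsub>G\<^esub> V \<subseteq> U))"

definition pretop_T0 :: "'a set \<Rightarrow> 'a set set \<Rightarrow> bool" where
  "pretop_T0 Z T \<longleftrightarrow>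
     (\<forall>y\<in>Z. \<forall>z\<in>Z. y \<noteq> z \<longrightarrow> (\<exists>V\<in>T. V \<inter> {y, z} = {y} \<or> V \<inter> {y, z} = {z}))"

definition pretop_T1 :: "'a set \<Rightarrow> 'a set set \<Rightarrow> bool" where
  "pretop_T1 Z T \<longleftrightarrow>
     (\<forall>y\<in>Z. \<forall>z\<in>Z. y \<noteq> z \<longrightarrow>
       (\<exists>V\<in>T. \<exists>W\<in>T. V \<inter> {y, z} = {y} \<and> W \<inter> {y, z} = {z}))"

definition functionally_separated :: "'a set \<Rightarrow> 'a set set \<Rightarrow> bool" where
  "functionally_separated Z T \<longleftrightarrow>
     (\<forall>z\<in>Z. \<forall>C. C \<subseteq> Z \<and> Z - C \<in> T \<and> z \<notin> C \<longrightarrow>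
       (\<exists>r :: 'a \<Rightarrow> real.
          precontinuous_map Z T {0..1} {U. openin (top_of_set {0..1}) U} r \<and>
          r z = 0 \<and> (\<forall>x\<in>C. r x = 1)))"

definition pretop_completely_regular :: "'a set \<Rightarrow> 'a set set \<Rightarrow> bool" where
  "pretop_completely_regular Z T \<longleftrightarrow> pretop_T1 Z T \<and> functionally_separated Z T"

text \<open>
  The definition of an almost topological group contains no separation axiom, while complete
  regularity includes \<open>T\<^sub>1\<close>. The indiscrete pre-topology therefore shows that an
  almost topological group is not completely regular without some separation axiom.
\<close>

lemma indiscrete_almost_topological_group:
  assumes "group G"
  shows "almost_topological_group G {{}, carrier G}"
proof -
  interpret group G by (rule assms)
  have "pretopology_on (carrier G) {{}, carrier G}"
    unfolding pretopology_on_def by auto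
  moreover have "precontinuous_map (carrier G) {{}, carrier G} (carrier G) {{}, carrier G}
      (\<lambda>x. inv\<^bsub>G\<^esub> x)"
  proof -
    have "{x \<in> carrier G. inv\<^bsub>G\<^esub> x \<in> carrier G} = carrier G" by auto
    then show ?thesis unfolding precontinuous_map_def by auto
  qed
  moreover have "precontinuous_map (carrier G \<times> carrier G)
      (prod_pretopology {{}, carrier G} {{}, carrier G}) (carrier G) {{}, carrier G}
      (\<lambda>(x, y). x \<otimes>\<^bsub>G\<^esub> y)"
  proof -
    have "{} \<in> prod_pretopology {{}, carrier G} {{}, carrier G}"
      unfolding prod_pretopology_def by (rule CollectI, rule exI[of _ "{}"]) auto
    moreover have "carrier G \<times> carrier G \<in> prod_pretopology {{}, carrier G} {{}, carrier G}"
      unfolding prod_pretopology_def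
      by (rule CollectI, rule exI[of _ "{carrier G \<times> carrier G}"]) auto
    moreover have "{p \<in> carrier G \<times> carrier G. (case p of (x, y) \<Rightarrow> x \<otimes>\<^bsub>G\<^esub> y) \<in> carrier G}
        = carrier G \<times> carrier G" by auto
    ultimately show ?thesis unfolding precontinuous_map_def by auto
  qed
  moreover have "prebase_at {{}, carrier G} \<one>\<^bsub>G\<^esub> {carrier G}"
    unfolding prebase_at_def by auto
  moreover have "carrier G = set_inv\<^bsub>G\<^esub> (carrier G)"
  proof
    show "carrier G \<subseteq> set_inv\<^bsub>G\<^esub> (carrier G)"
    proof
      fix x assume x: "x \<in> carrier G"
      have "x = inv\<^bsub>G\<^esub> (inv\<^bsub>G\<^esub> x)" using x by (simp only: inv_inv)
      then show "x \<in> set_inv\<^bsub>G\<^esub> (carrier G)"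
        unfolding SET_INV_def using inv_closed[OF x] by blast
    qed
    show "set_inv\<^bsub>G\<^esub> (carrier G) \<subseteq> carrier G"
      unfolding SET_INV_def by (simp add: UN_subset_iff)
  qed
  moreover have "carrier G <#>\<^bsub>G\<^esub> carrier G \<subseteq> carrier G"
    unfolding set_mult_def by auto
  ultimately show ?thesis
    unfolding almost_topological_group_def pretopological_group_def
    using assms by blast
qed

lemma indiscrete_not_completely_regular:
  assumes "x \<in> Z" "y \<in> Z" "x \<noteq> y"
  shows "\<not> pretop_completely_regular Z {{}, Z}"
proof
  assume "pretop_completely_regular Z {{}, Z}"
  then obtain V where "V \<in> {{}, Z}" "V \<inter> {x, y} = {x}"
    using assms unfolding pretop_completely_regular_def pretop_T1_def by meson
  then have "x \<in> V" "y \<notin> V" using assms(3) by auto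
  with \<open>V \<in> {{}, Z}\<close> show False using assms(2) by auto
qed

end

theory Submission
  imports Defs
begin

text \<open>
  The argument is the Birkhoff--Kakutani construction, carried out so that it never intersects two
  open sets. Given an open set \<open>O\<close> around the neutral element, choose symmetric members
  \<open>U 0 \<subseteq> O\<close>, \<open>U 1\<close>, \<open>U 2\<close>, \<dots> of the pre-base such that a product of three elements of
  \<open>U (n + 1)\<close> lies in \<open>U n\<close>. Give an element of \<open>U n\<close> the cost \<open>2\<^sup>-\<^sup>n\<close>, and let the gauge of \<open>g\<close> be
  the least total cost of writing \<open>g\<close> as a product of such elements, truncated at \<open>1\<close>.

  Appending one factor shows that the gauge changes by at most \<open>2\<^sup>-\<^sup>n\<close> when \<open>g\<close> is multiplied on
  the right by an element of \<open>U n\<close> (\<open>word_gauge_mult_right_close\<close>). The substantial point is that the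
  gauge does not collapse: a product of total cost less than \<open>2\<^sup>-\<^sup>n\<close> lies in \<open>U n\<close>
  (\<open>word_set_subset\<close>), so the gauge equals \<open>1\<close> outside \<open>U 0\<close>.
  The function \<open>x \<mapsto> word_gauge U (z\<inverse> x)\<close> then separates \<open>z\<close> from the complement of \<open>z O\<close>.

  A pre-topology need not contain the intersection of the preimages of \<open>(-\<infinity>, b)\<close> and
  \<open>(a, \<infinity>)\<close>, so for pre-continuity semicontinuity from both sides would not suffice. The two-sided
  bound on the gauge does: it gives every point of the preimage of an open set a single translate
  of some \<open>U n\<close> inside that preimage, and arbitrary unions are allowed.

  For the step from \<open>T\<^sub>0\<close> to \<open>T\<^sub>1\<close>, symmetry of the pre-base turns an open set that contains \<open>y\<close> but not
  \<open>z\<close> into one that contains \<open>z\<close> but not \<open>y\<close>.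
\<close>

section \<open>Translations in a pre-topological group\<close>

lemma pretopology_on_localI:
  assumes "pretopology_on Z T"
    and "\<And>x. x \<in> S \<Longrightarrow> \<exists>W\<in>T. x \<in> W \<and> W \<subseteq> S"
  shows "S \<in> T"
proof -
  have "\<Union>{W \<in> T. W \<subseteq> S} = S"
  proof
    show "S \<subseteq> \<Union>{W \<in> T. W \<subseteq> S}"
    proof
      fix x assume "x \<in> S"
      then obtain W where "W \<in> T" "x \<in> W" "W \<subseteq> S" using assms(2) by auto
      then show "x \<in> \<Union>{W \<in> T. W \<subseteq> S}" by auto
    qed
  qed auto
  moreover have "{W \<in> T. W \<subseteq> S} \<subseteq> T" by simp
  then have "\<Union>{W \<in> T. W \<subseteq> S} \<in> T"
    using assms(1) by (simp only: pretopology_on_def)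
  ultimately show ?thesis by simp
qed

text \<open>
  Joint pre-continuity of the multiplication reaches the translations through this lemma: a slice
  of a union of rectangles is a union of their second sides, so again no intersection is formed.
\<close>

lemma prod_pretopology_slice:
  assumes T: "pretopology_on Z T" and P: "P \<in> prod_pretopology S T"
  shows "{y. (a, y) \<in> P} \<in> T"
proof (rule pretopology_on_localI[OF T])
  fix y assume y: "y \<in> {y. (a, y) \<in> P}"
  obtain K where K: "P = \<Union>K" "K \<subseteq> {U \<times> V | U V. U \<in> S \<and> V \<in> T}"
    using P unfolding prod_pretopology_def by auto
  obtain U V where UV: "U \<times> V \<in> K" "V \<in> T" "a \<in> U" "y \<in> V"
    using y K by auto
  then have "V \<subseteq> {y. (a, y) \<in> P}" using K(1) by auto
  then show "\<exists>W\<in>T. y \<in> W \<and> W \<subseteq> {y. (a, y) \<in> P}" using UV by auto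
qed

lemma left_translate_open:
  assumes G: "pretopological_group G T" and a: "a \<in> carrier G" and W: "W \<in> T"
  shows "{x \<in> carrier G. a \<otimes>\<^bsub>G\<^esub> x \<in> W} \<in> T"
proof -
  define P where "P = {p \<in> carrier G \<times> carrier G. (case p of (x, y) \<Rightarrow> x \<otimes>\<^bsub>G\<^esub> y) \<in> W}"
  have T: "pretopology_on (carrier G) T"
    using G by (simp add: pretopological_group_def)
  have "P \<in> prod_pretopology T T"
    using G W unfolding pretopological_group_def precontinuous_map_def P_def
    by (elim conjE) (erule (1) bspec)
  then have "{y. (a, y) \<in> P} \<in> T"
    by (rule prod_pretopology_slice[OF T])
  moreover have "{y. (a, y) \<in> P} = {x \<in> carrier G. a \<otimes>\<^bsub>G\<^esub> x \<in> W}"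
    unfolding P_def using a by auto
  ultimately show ?thesis by simp
qed

section \<open>The gauge of a sequence of symmetric sets\<close>

definition dyadic_cost :: "nat list \<Rightarrow> real" where
  "dyadic_cost ns = (\<Sum>n\<leftarrow>ns. (1/2) ^ n)"

lemma dyadic_cost_simps [simp]:
  "dyadic_cost [] = 0"
  "dyadic_cost (n # ns) = (1/2) ^ n + dyadic_cost ns"
  "dyadic_cost (ms @ ns) = dyadic_cost ms + dyadic_cost ns"
  by (simp_all add: dyadic_cost_def)

lemma dyadic_cost_nonneg: "0 \<le> dyadic_cost ns"
  by (induction ns) simp_all

text \<open>
  The middle entry is the one at which the partial sums first reach \<open>t\<close>.
\<close>

lemma dyadic_cost_split:
  assumes "ns \<noteq> []" "0 \<le> t" "t \<le> dyadic_cost ns"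
  shows "\<exists>ms k ls. ns = ms @ k # ls \<and> dyadic_cost ms \<le> t \<and> dyadic_cost ls \<le> dyadic_cost ns - t"
  using assms
proof (induction ns arbitrary: t)
  case Nil
  then show ?case by simp
next
  case (Cons n ns)
  show ?case
  proof (cases "t \<le> (1/2) ^ n")
    case True
    then have "n # ns = [] @ n # ns \<and> dyadic_cost [] \<le> t
        \<and> dyadic_cost ns \<le> dyadic_cost (n # ns) - t"
      using Cons.prems by simp
    then show ?thesis by blast
  next
    case False
    then have "ns \<noteq> []" "0 \<le> t - (1/2) ^ n" "t - (1/2) ^ n \<le> dyadic_cost ns"
      using Cons.prems by auto
    from Cons.IH[OF this] obtain ms k ls where
      "ns = ms @ k # ls" "dyadic_cost ms \<le> t - (1/2) ^ n"
      "dyadic_cost ls \<le> dyadic_cost ns - (t - (1/2) ^ n)"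
      by blast
    then have "n # ns = (n # ms) @ k # ls \<and> dyadic_cost (n # ms) \<le> t
        \<and> dyadic_cost ls \<le> dyadic_cost (n # ns) - t"
      by simp
    then show ?thesis by blast
  qed
qed

lemma set_multI: "h \<in> H \<Longrightarrow> k \<in> K \<Longrightarrow> h \<otimes>\<^bsub>G\<^esub> k \<in> H <#>\<^bsub>G\<^esub> K"
  by (auto simp: set_mult_def)

context group
begin

definition word_set :: "(nat \<Rightarrow> 'a set) \<Rightarrow> nat list \<Rightarrow> 'a set" where
  "word_set U ns = foldr (\<lambda>n A. U n <#> A) ns {\<one>}"

lemma word_set_simps [simp]:
  "word_set U [] = {\<one>}"
  "word_set U (n # ns) = U n <#> word_set U ns"
  by (simp_all add: word_set_def)

lemma word_set_closed:
  assumes "\<And>n. U n \<subseteq> carrier G"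
  shows "word_set U ns \<subseteq> carrier G"
  using assms by (induction ns) (simp_all add: set_mult_closed)

lemma word_set_append:
  assumes U: "\<And>n. U n \<subseteq> carrier G"
  shows "word_set U (ms @ ns) = word_set U ms <#> word_set U ns"
proof (induction ms)
  case Nil
  have "\<And>x. x \<in> word_set U ns \<Longrightarrow> \<one> \<otimes> x = x"
    using word_set_closed[of U ns, OF U] by auto
  then show ?case by (simp add: set_mult_def)
next
  case (Cons m ms)
  then show ?case
    by (simp add: set_mult_assoc[OF U word_set_closed[of U, OF U] word_set_closed[of U, OF U]])
qed

text \<open>
  The cost \<open>1\<close> is included both as the truncation and because an element need not be a product
  of members of the \<open>U n\<close> at all.
\<close>

definition word_gauge_costs :: "(nat \<Rightarrow> 'a set) \<Rightarrow> 'a \<Rightarrow> real set" where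
  "word_gauge_costs U g = insert 1 {dyadic_cost ns | ns. g \<in> word_set U ns}"

definition word_gauge :: "(nat \<Rightarrow> 'a set) \<Rightarrow> 'a \<Rightarrow> real" where
  "word_gauge U g = Inf (word_gauge_costs U g)"

lemma word_gauge_costs_nonneg: "s \<in> word_gauge_costs U g \<Longrightarrow> 0 \<le> s"
  unfolding word_gauge_costs_def using dyadic_cost_nonneg by auto

lemma word_gauge_le: "s \<in> word_gauge_costs U g \<Longrightarrow> word_gauge U g \<le> s"
  unfolding word_gauge_def
  by (rule cInf_lower) (auto intro!: bdd_belowI[of _ 0] word_gauge_costs_nonneg)

lemma word_gauge_ge:
  assumes "\<And>s. s \<in> word_gauge_costs U g \<Longrightarrow> c \<le> s"
  shows "c \<le> word_gauge U g"
  unfolding word_gauge_def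
  by (rule cInf_greatest) (use assms in \<open>auto simp: word_gauge_costs_def\<close>)

lemma word_gauge_bounds: "0 \<le> word_gauge U g" "word_gauge U g \<le> 1"
  by (auto intro: word_gauge_ge word_gauge_costs_nonneg word_gauge_le simp: word_gauge_costs_def)

lemma word_gauge_one: "word_gauge U \<one> = 0"
proof (rule antisym)
  have "dyadic_cost [] \<in> word_gauge_costs U \<one>"
    unfolding word_gauge_costs_def using word_set_simps(1) by blast
  then show "word_gauge U \<one> \<le> 0" using word_gauge_le by fastforce
qed (rule word_gauge_bounds)

lemma word_gauge_mult_right_le:
  assumes U: "\<And>n. U n \<subseteq> carrier G" and u: "u \<in> U n"
  shows "word_gauge U (g \<otimes> u) \<le> word_gauge U g + (1/2) ^ n"
proof -
  have "word_gauge U (g \<otimes> u) - (1/2) ^ n \<le> s" if s: "s \<in> word_gauge_costs U g" for s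
  proof (cases "s = 1")
    case True
    have "word_gauge U (g \<otimes> u) \<le> 1" "(0::real) \<le> (1/2) ^ n"
      by (simp_all add: word_gauge_bounds)
    with True show ?thesis by linarith
  next
    case False
    with s obtain ns where ns: "s = dyadic_cost ns" "g \<in> word_set U ns"
      unfolding word_gauge_costs_def by auto
    have "u \<otimes> \<one> = u" using U[of n] u by auto
    then have "u \<in> word_set U [n]"
      using u by (force simp: set_mult_def)
    then have "g \<otimes> u \<in> word_set U (ns @ [n])"
      unfolding word_set_append[of U, OF U] by (intro set_multI ns(2))
    then have "dyadic_cost (ns @ [n]) \<in> word_gauge_costs U (g \<otimes> u)"
      unfolding word_gauge_costs_def by blast
    from word_gauge_le[OF this] show ?thesis using ns(1) by simp
  qed
  then have "word_gauge U (g \<otimes> u) - (1/2) ^ n \<le> word_gauge U g"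
    by (rule word_gauge_ge)
  then show ?thesis by simp
qed

lemma word_gauge_mult_right_close:
  assumes U: "\<And>n. U n \<subseteq> carrier G" and inv: "\<And>n x. x \<in> U n \<Longrightarrow> inv x \<in> U n"
    and g: "g \<in> carrier G" and u: "u \<in> U n"
  shows "\<bar>word_gauge U (g \<otimes> u) - word_gauge U g\<bar> \<le> (1/2) ^ n"
proof -
  have "u \<in> carrier G" using U[of n] u by blast
  then have "(g \<otimes> u) \<otimes> inv u = g" using g by (simp add: m_assoc)
  then have "word_gauge U g \<le> word_gauge U (g \<otimes> u) + (1/2) ^ n"
    using word_gauge_mult_right_le[of U "inv u" n "g \<otimes> u", OF U inv[OF u]] by simp
  then show ?thesis
    using word_gauge_mult_right_le[of U u n g, OF U u] by linarith
qed

text \<open>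
  Cut a word of cost \<open>s < 2\<^sup>-\<^sup>n\<close> at its midpoint in cost: the parts before and after the middle
  letter cost at most \<open>s / 2 < 2\<^sup>-\<^sup>(\<^sup>n\<^sup>+\<^sup>1\<^sup>)\<close> each, and the middle letter itself has an index larger
  than \<open>n\<close>. So by induction on the length the word is a product of three elements of \<open>U (n + 1)\<close>.
\<close>

lemma word_set_subset:
  assumes one: "\<And>n. \<one> \<in> U n" and U: "\<And>n. U n \<subseteq> carrier G"
    and triple: "\<And>n. U (Suc n) <#> (U (Suc n) <#> U (Suc n)) \<subseteq> U n"
    and cost: "dyadic_cost ns < (1/2) ^ n"
  shows "word_set U ns \<subseteq> U n"
  using cost
proof (induction "length ns" arbitrary: ns n rule: less_induct)
  case less
  have step: "U (Suc i) \<subseteq> U i" for i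
  proof
    fix x assume x: "x \<in> U (Suc i)"
    then have "x = x \<otimes> (\<one> \<otimes> \<one>)" using U[of "Suc i"] by auto
    also have "\<dots> \<in> U (Suc i) <#> (U (Suc i) <#> U (Suc i))"
      using x one by (intro set_multI)
    finally show "x \<in> U i" using triple[of i] by blast
  qed
  show ?case
  proof (cases "ns = []")
    case True
    then show ?thesis using one by simp
  next
    case False
    define t where "t = dyadic_cost ns / 2"
    have t: "0 \<le> t" "t \<le> dyadic_cost ns" "t < (1/2) ^ Suc n"
      using dyadic_cost_nonneg[of ns] less.prems by (auto simp: t_def)
    obtain ms k ls where split: "ns = ms @ k # ls"
      and cost: "dyadic_cost ms \<le> t" "dyadic_cost ls \<le> dyadic_cost ns - t"
      using dyadic_cost_split[OF False t(1,2)] by blast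
    have cost_ls: "dyadic_cost ls \<le> t" using cost(2) by (simp add: t_def)
    have "word_set U ms \<subseteq> U (Suc n)"
      by (rule less.hyps) (use split cost(1) t(3) in auto)
    moreover have "word_set U ls \<subseteq> U (Suc n)"
      by (rule less.hyps) (use split cost_ls t(3) in auto)
    moreover have "U k \<subseteq> U (Suc n)"
    proof -
      have "(1/2) ^ k \<le> dyadic_cost ns"
        using split dyadic_cost_nonneg[of ms] dyadic_cost_nonneg[of ls] by simp
      then have "(1/2 :: real) ^ k < (1/2) ^ n" using less.prems by linarith
      then have "n < k" by simp
      then show ?thesis
        using lift_Suc_antimono_le[of U, OF step, of "Suc n" k] by simp
    qed
    ultimately have "word_set U ms <#> (U k <#> word_set U ls)
        \<subseteq> U (Suc n) <#> (U (Suc n) <#> U (Suc n))"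
      by (intro mono_set_mult)
    then show ?thesis
      using triple[of n] split by (simp add: word_set_append[of U, OF U])
  qed
qed

lemma word_gauge_eq_one:
  assumes "\<And>n. \<one> \<in> U n" and "\<And>n. U n \<subseteq> carrier G"
    and "\<And>n. U (Suc n) <#> (U (Suc n) <#> U (Suc n)) \<subseteq> U n"
    and "g \<notin> U 0"
  shows "word_gauge U g = 1"
proof (rule antisym)
  show "1 \<le> word_gauge U g"
  proof (rule word_gauge_ge, rule ccontr)
    fix s assume "s \<in> word_gauge_costs U g" "\<not> 1 \<le> s"
    then obtain ns where "dyadic_cost ns < (1/2) ^ 0" "g \<in> word_set U ns"
      unfolding word_gauge_costs_def by force
    then show False
      using word_set_subset[of U ns 0, OF assms(1-3)] assms(4) by blast
  qed
qed (rule word_gauge_bounds)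

end

section \<open>Separation in almost topological groups\<close>

lemma almost_topological_group_prebase:
  assumes "almost_topological_group G T"
  shows "\<exists>B. prebase_at T \<one>\<^bsub>G\<^esub> B \<and> (\<forall>U\<in>B. U \<subseteq> carrier G) \<and>
    (\<forall>U\<in>B. \<forall>x\<in>U. inv\<^bsub>G\<^esub> x \<in> U) \<and> (\<forall>U\<in>B. \<exists>V\<in>B. V <#>\<^bsub>G\<^esub> V \<subseteq> U)"
proof -
  obtain B where B: "prebase_at T \<one>\<^bsub>G\<^esub> B" "\<forall>U\<in>B. U = set_inv\<^bsub>G\<^esub> U"
      "\<forall>U\<in>B. \<exists>V\<in>B. V <#>\<^bsub>G\<^esub> V \<subseteq> U"
    using assms unfolding almost_topological_group_def by blast
  have "\<Union>T = carrier G"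
    using assms by (simp add: almost_topological_group_def pretopological_group_def pretopology_on_def)
  then have "U \<subseteq> carrier G" if "U \<in> B" for U
    using that B(1) unfolding prebase_at_def by blast
  moreover have "inv\<^bsub>G\<^esub> x \<in> U" if "U \<in> B" "x \<in> U" for U x
  proof -
    have "inv\<^bsub>G\<^esub> x \<in> set_inv\<^bsub>G\<^esub> U" using that(2) by (auto simp: SET_INV_def)
    then show ?thesis using bspec[OF B(2) that(1)] by (simp only:)
  qed
  ultimately show ?thesis using B(1,3) by (intro exI[of _ B]) auto
qed

text \<open>
  Two halvings \<open>W\<^sup>2 \<subseteq> V\<close> and \<open>V\<^sup>2 \<subseteq> U\<close> give \<open>W\<^sup>4 \<subseteq> U\<close>, and the neutral element fills the
  fourth factor.
\<close>

lemma prebase_triple_sequence: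
  assumes "group G" and B: "prebase_at T \<one>\<^bsub>G\<^esub> B"
    and closed: "\<forall>U\<in>B. U \<subseteq> carrier G"
    and square: "\<forall>U\<in>B. \<exists>V\<in>B. V <#>\<^bsub>G\<^esub> V \<subseteq> U"
    and W: "W \<in> T" "\<one>\<^bsub>G\<^esub> \<in> W"
  shows "\<exists>U. (\<forall>n::nat. U n \<in> B) \<and> U 0 \<subseteq> W \<and>
    (\<forall>n. U (Suc n) <#>\<^bsub>G\<^esub> (U (Suc n) <#>\<^bsub>G\<^esub> U (Suc n)) \<subseteq> U n)"
proof -
  interpret group G by fact
  have triple: "\<exists>V\<in>B. V <#>\<^bsub>G\<^esub> (V <#>\<^bsub>G\<^esub> V) \<subseteq> U" if U: "U \<in> B" for U
  proof -
    obtain V where V: "V \<in> B" "V <#>\<^bsub>G\<^esub> V \<subseteq> U" using bspec[OF square U] by auto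
    obtain W where W: "W \<in> B" "W <#>\<^bsub>G\<^esub> W \<subseteq> V" using bspec[OF square V(1)] by auto
    have "W \<subseteq> V"
    proof
      fix x assume x: "x \<in> W"
      then have "x = x \<otimes>\<^bsub>G\<^esub> \<one>\<^bsub>G\<^esub>" using bspec[OF closed W(1)] by auto
      also have "\<dots> \<in> W <#>\<^bsub>G\<^esub> W"
        using x B W(1) by (intro set_multI) (auto simp: prebase_at_def)
      finally show "x \<in> V" using W(2) by blast
    qed
    then have "W <#>\<^bsub>G\<^esub> (W <#>\<^bsub>G\<^esub> W) \<subseteq> V <#>\<^bsub>G\<^esub> V"
      using W(2) by (intro mono_set_mult)
    then show ?thesis using V(2) W(1) by blast
  qed
  have "\<exists>U. \<forall>n. (U n \<in> B \<and> (n = 0 \<longrightarrow> U n \<subseteq> W)) \<and>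
      U (Suc n) <#>\<^bsub>G\<^esub> (U (Suc n) <#>\<^bsub>G\<^esub> U (Suc n)) \<subseteq> U n"
  proof (rule dependent_nat_choice)
    show "\<exists>x. x \<in> B \<and> (0 = (0::nat) \<longrightarrow> x \<subseteq> W)"
      using B W unfolding prebase_at_def by blast
    show "\<exists>y. (y \<in> B \<and> (Suc n = 0 \<longrightarrow> y \<subseteq> W)) \<and> y <#>\<^bsub>G\<^esub> (y <#>\<^bsub>G\<^esub> y) \<subseteq> x"
      if "x \<in> B \<and> (n = 0 \<longrightarrow> x \<subseteq> W)" for x n
      using triple[of x] that by auto
  qed
  then obtain U :: "nat \<Rightarrow> 'a set" where "\<forall>n. (U n \<in> B \<and> (n = 0 \<longrightarrow> U n \<subseteq> W)) \<and>
      U (Suc n) <#>\<^bsub>G\<^esub> (U (Suc n) <#>\<^bsub>G\<^esub> U (Suc n)) \<subseteq> U n" ..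
  then show ?thesis by (intro exI[of _ U]) auto
qed

lemma almost_topological_group_functionally_separated:
  assumes G: "almost_topological_group G T"
  shows "functionally_separated (carrier G) T"
  unfolding functionally_separated_def
proof (intro ballI allI impI, elim conjE)
  fix z C
  assume z: "z \<in> carrier G" and C: "C \<subseteq> carrier G" "carrier G - C \<in> T" "z \<notin> C"
  have G': "pretopological_group G T" and gr: "group G" and T: "pretopology_on (carrier G) T"
    using G unfolding almost_topological_group_def pretopological_group_def by auto
  interpret group G by (rule gr)
  obtain B where B: "prebase_at T \<one>\<^bsub>G\<^esub> B"
    and closed: "\<forall>U\<in>B. U \<subseteq> carrier G"
    and sym: "\<forall>U\<in>B. \<forall>x\<in>U. inv\<^bsub>G\<^esub> x \<in> U"
    and square: "\<forall>U\<in>B. \<exists>V\<in>B. V <#>\<^bsub>G\<^esub> V \<subseteq> U"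
    using almost_topological_group_prebase[OF G] by (elim exE conjE) (rule that)
  have W: "{x \<in> carrier G. z \<otimes>\<^bsub>G\<^esub> x \<in> carrier G - C} \<in> T"
    by (rule left_translate_open[OF G' z C(2)])
  have zW: "\<one>\<^bsub>G\<^esub> \<in> {x \<in> carrier G. z \<otimes>\<^bsub>G\<^esub> x \<in> carrier G - C}" using z C(3) by simp
  obtain U where UB: "\<forall>n::nat. U n \<in> B"
    and U0: "U 0 \<subseteq> {x \<in> carrier G. z \<otimes>\<^bsub>G\<^esub> x \<in> carrier G - C}"
    and triple: "\<forall>n. U (Suc n) <#>\<^bsub>G\<^esub> (U (Suc n) <#>\<^bsub>G\<^esub> U (Suc n)) \<subseteq> U n"
    using prebase_triple_sequence[OF gr B closed square W zW] by (elim exE conjE) (rule that)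
  have UT: "U n \<in> T" and one: "\<one>\<^bsub>G\<^esub> \<in> U n" and Uc: "U n \<subseteq> carrier G" for n
    using spec[OF UB, of n] B closed by (auto simp: prebase_at_def)
  have Ui: "\<And>n x. x \<in> U n \<Longrightarrow> inv\<^bsub>G\<^esub> x \<in> U n"
    using bspec[OF sym spec[OF UB]] by simp
  define r where "r x = word_gauge U (inv\<^bsub>G\<^esub> z \<otimes>\<^bsub>G\<^esub> x)" for x
  have "{x \<in> carrier G. r x \<in> V} \<in> T" if openV: "openin (top_of_set {0..1}) V" for V
  proof (rule pretopology_on_localI[OF T])
    fix x assume "x \<in> {x \<in> carrier G. r x \<in> V}"
    then have x: "x \<in> carrier G" "r x \<in> V" by auto
    obtain e where e: "e > 0" "ball (r x) e \<inter> {0..1} \<subseteq> V"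
      using bspec[OF conjunct2[OF iffD1[OF openin_contains_ball openV]] x(2)] by auto
    obtain n where n: "(1/2) ^ n < e"
      using real_arch_pow_inv[OF e(1), of "1/2"] by auto
    let ?W = "{y \<in> carrier G. inv\<^bsub>G\<^esub> x \<otimes>\<^bsub>G\<^esub> y \<in> U n}"
    have "?W \<in> T"
      using left_translate_open[OF G' inv_closed[OF x(1)] UT] .
    moreover have "x \<in> ?W" using x(1) one by simp
    moreover have "?W \<subseteq> {x \<in> carrier G. r x \<in> V}"
    proof (intro subsetI CollectI conjI)
      fix y assume y: "y \<in> ?W"
      then show "y \<in> carrier G" by simp
      let ?u = "inv\<^bsub>G\<^esub> x \<otimes>\<^bsub>G\<^esub> y"
      have "(inv\<^bsub>G\<^esub> z \<otimes>\<^bsub>G\<^esub> x) \<otimes>\<^bsub>G\<^esub> ?u = inv\<^bsub>G\<^esub> z \<otimes>\<^bsub>G\<^esub> (x \<otimes>\<^bsub>G\<^esub> ?u)"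
        using x(1) y z by (simp add: m_assoc)
      also have "x \<otimes>\<^bsub>G\<^esub> ?u = y"
        using x(1) y by (simp add: m_assoc[symmetric])
      finally have "\<bar>r y - r x\<bar> \<le> (1/2) ^ n"
        using word_gauge_mult_right_close[of U "inv\<^bsub>G\<^esub> z \<otimes>\<^bsub>G\<^esub> x" ?u n, OF Uc Ui] x(1) y z
        by (simp add: r_def)
      then have "r y \<in> ball (r x) e" using n by (simp add: dist_real_def abs_minus_commute)
      moreover have "r y \<in> {0..1}" by (simp add: r_def word_gauge_bounds)
      ultimately show "r y \<in> V" by (intro subsetD[OF e(2)] IntI)
    qed
    ultimately show "\<exists>W\<in>T. x \<in> W \<and> W \<subseteq> {x \<in> carrier G. r x \<in> V}"
      by (intro bexI[of _ ?W] conjI)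
  qed
  then have "precontinuous_map (carrier G) T {0..1} {U. openin (top_of_set {0..1}) U} r"
    by (simp add: precontinuous_map_def r_def word_gauge_bounds)
  moreover have "r z = 0" using z by (simp add: r_def word_gauge_one)
  moreover have "r x = 1" if x: "x \<in> C" for x
  proof -
    have "z \<otimes>\<^bsub>G\<^esub> (inv\<^bsub>G\<^esub> z \<otimes>\<^bsub>G\<^esub> x) = x"
      using x z C(1) by (simp add: m_assoc[symmetric] subset_iff)
    then have "inv\<^bsub>G\<^esub> z \<otimes>\<^bsub>G\<^esub> x \<notin> U 0" using U0 x by auto
    then show ?thesis unfolding r_def by (intro word_gauge_eq_one one Uc spec[OF triple])
  qed
  ultimately show "\<exists>r :: 'a \<Rightarrow> real.
      precontinuous_map (carrier G) T {0..1} {U. openin (top_of_set {0..1}) U} r \<and>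
      r z = 0 \<and> (\<forall>x\<in>C. r x = 1)"
    by (intro exI[of _ r] conjI ballI)
qed

text \<open>
  If \<open>U\<close> is a symmetric member of the pre-base with \<open>y U \<subseteq> V\<close>, then \<open>z U\<close> is the required set:
  \<open>y \<in> z U\<close> would mean \<open>z\<inverse> y \<in> U\<close>, hence \<open>y\<inverse> z \<in> U\<close> and \<open>z \<in> V\<close>.
\<close>

lemma almost_topological_group_swap_separation:
  assumes G: "almost_topological_group G T"
    and y: "y \<in> carrier G" and z: "z \<in> carrier G"
    and V: "V \<in> T" "y \<in> V" "z \<notin> V"
  shows "\<exists>W\<in>T. z \<in> W \<and> y \<notin> W"
proof -
  have G': "pretopological_group G T" and gr: "group G"
    using G unfolding almost_topological_group_def pretopological_group_def by auto
  interpret group G by (rule gr)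
  obtain B where B: "prebase_at T \<one>\<^bsub>G\<^esub> B"
    and sym: "\<forall>U\<in>B. \<forall>x\<in>U. inv\<^bsub>G\<^esub> x \<in> U"
    using almost_topological_group_prebase[OF G] by (elim exE conjE) (rule that)
  have "{x \<in> carrier G. y \<otimes>\<^bsub>G\<^esub> x \<in> V} \<in> T"
    by (rule left_translate_open[OF G' y V(1)])
  moreover have "\<one>\<^bsub>G\<^esub> \<in> {x \<in> carrier G. y \<otimes>\<^bsub>G\<^esub> x \<in> V}" using y V(2) by simp
  ultimately obtain U where U: "U \<in> B" "U \<subseteq> {x \<in> carrier G. y \<otimes>\<^bsub>G\<^esub> x \<in> V}"
    using B unfolding prebase_at_def by meson
  then have UT: "U \<in> T" "\<one>\<^bsub>G\<^esub> \<in> U" using B unfolding prebase_at_def by auto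
  let ?W = "{x \<in> carrier G. inv\<^bsub>G\<^esub> z \<otimes>\<^bsub>G\<^esub> x \<in> U}"
  have "?W \<in> T"
    by (rule left_translate_open[OF G' inv_closed[OF z] UT(1)])
  moreover have "z \<in> ?W" using z UT(2) by simp
  moreover have "y \<notin> ?W"
  proof
    assume "y \<in> ?W"
    then have "inv\<^bsub>G\<^esub> (inv\<^bsub>G\<^esub> z \<otimes>\<^bsub>G\<^esub> y) \<in> U" using bspec[OF sym U(1)] by blast
    then have "inv\<^bsub>G\<^esub> y \<otimes>\<^bsub>G\<^esub> z \<in> U" using y z by (simp add: inv_mult_group)
    then have "y \<otimes>\<^bsub>G\<^esub> (inv\<^bsub>G\<^esub> y \<otimes>\<^bsub>G\<^esub> z) \<in> V" using U(2) by blast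
    then show False using y z V(3) by (simp add: m_assoc[symmetric])
  qed
  ultimately show ?thesis by (intro bexI[of _ ?W] conjI)
qed

lemma inter_pair_eq_singleton_iff:
  assumes "a \<noteq> b"
  shows "V \<inter> {a, b} = {a} \<longleftrightarrow> a \<in> V \<and> b \<notin> V"
    and "V \<inter> {a, b} = {b} \<longleftrightarrow> b \<in> V \<and> a \<notin> V"
  using assms by auto

lemma almost_topological_group_T0_imp_T1:
  assumes G: "almost_topological_group G T" and T0: "pretop_T0 (carrier G) T"
  shows "pretop_T1 (carrier G) T"
  unfolding pretop_T1_def
proof (intro ballI impI)
  fix y z assume yz: "y \<in> carrier G" "z \<in> carrier G" "y \<noteq> z"
  note pair = inter_pair_eq_singleton_iff[OF yz(3)]
  have "\<exists>V\<in>T. V \<inter> {y, z} = {y} \<or> V \<inter> {y, z} = {z}"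
    by (rule mp[OF bspec[OF bspec[OF T0[unfolded pretop_T0_def] yz(1)] yz(2)] yz(3)])
  then obtain V where V: "V \<in> T" and "(y \<in> V \<and> z \<notin> V) \<or> (z \<in> V \<and> y \<notin> V)"
    unfolding pair by (elim bexE) (rule that)
  then show "\<exists>V\<in>T. \<exists>W\<in>T. V \<inter> {y, z} = {y} \<and> W \<inter> {y, z} = {z}"
    unfolding pair
  proof (elim disjE conjE)
    assume yV: "y \<in> V" "z \<notin> V"
    obtain W where "W \<in> T" "z \<in> W \<and> y \<notin> W"
      using almost_topological_group_swap_separation[OF G yz(1,2) V yV] by (elim bexE) (rule that)
    with V yV show "\<exists>V\<in>T. \<exists>W\<in>T. (y \<in> V \<and> z \<notin> V) \<and> (z \<in> W \<and> y \<notin> W)"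
      by (intro bexI[of _ V] bexI[of _ W] conjI) simp_all
  next
    assume zV: "z \<in> V" "y \<notin> V"
    obtain W where "W \<in> T" "y \<in> W \<and> z \<notin> W"
      using almost_topological_group_swap_separation[OF G yz(2,1) V zV] by (elim bexE) (rule that)
    with V zV show "\<exists>V\<in>T. \<exists>W\<in>T. (y \<in> V \<and> z \<notin> V) \<and> (z \<in> W \<and> y \<notin> W)"
      by (intro bexI[of _ W] bexI[of _ V] conjI) simp_all
  qed
qed

theorem theorem6p6:
  fixes G :: "('a, 'b) monoid_scheme" and T :: "'a set set"
  assumes "almost_topological_group G T"
  shows "functionally_separated (carrier G) T \<and>
         (pretop_T0 (carrier G) T \<longrightarrow> pretop_completely_regular (carrier G) T)"
  using almost_topological_group_functionally_separated[OF assms]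
    almost_topological_group_T0_imp_T1[OF assms]
  unfolding pretop_completely_regular_def by blast

end
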